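(* Let $A$ be a non-Whitehead abelian group, $0\to K\to F\to A\to 0$ a short exact sequence with $F,K$ free and $K\subseteq F$, and $\tau\in\mathrm{Hom}(K,\mathbb{Z})$ a homomorphism not extending to any $\sigma\in\mathrm{Hom}(F,\mathbb{Z})$. Let $B_F$ be a basis of $F$, $e:B_F\to\omega$ a function, and $\mathbb{B}$ a complete Boolean algebra (all in $V$). Then in $V^{\mathbb{B}}$ there is no homomorphism $\sigma\in\mathrm{Hom}(F,\mathbb{Z})$ with $\sigma\restriction K=\tau$ and $|\sigma(y)|\le e(y)$ for all $y\in B_F$.
   Context: An abelian group $A$ is Whitehead if $\mathrm{Ext}^1(A,\mathbb{Z})=0$. *)

theory Defs
  imports
    "HOL-Algebra.Exact_Sequence"
    "HOL-Algebra.Free_Abelian_Groups"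
    "HOL-Library.Equipollence"
begin

section \<open>Bases of abelian groups, \<open>Ext\<^sup>1\<close> and Whitehead groups\<close>

text \<open>Abelian groups are written multiplicatively, as everywhere in HOL-Algebra.
  The integer combination with coefficients \<open>c\<close>:\<close>

definition int_comb :: "('a, 'm) monoid_scheme \<Rightarrow> ('a \<Rightarrow>\<^sub>0 int) \<Rightarrow> 'a" where
  "int_comb G c = finprod G (\<lambda>x. x [^]\<^bsub>G\<^esub> Poly_Mapping.lookup c x) (Poly_Mapping.keys c)"

definition is_basis :: "('a, 'm) monoid_scheme \<Rightarrow> 'a set \<Rightarrow> bool" where
  "is_basis G S \<longleftrightarrow> S \<subseteq> carrier G \<and> int_comb G \<in> iso (free_Abelian_group S) G"

definition is_free_abelian :: "('a, 'm) monoid_scheme \<Rightarrow> bool" where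
  "is_free_abelian G \<longleftrightarrow> comm_group G \<and> (\<exists>S. is_basis G S)"

definition hom_group :: "('a, 'm) monoid_scheme \<Rightarrow> ('b, 'n) monoid_scheme \<Rightarrow> ('a \<Rightarrow> 'b) monoid" where
  "hom_group G H =
     \<lparr>carrier = hom G H \<inter> extensional (carrier G),
      monoid.mult = (\<lambda>f g. \<lambda>x\<in>carrier G. f x \<otimes>\<^bsub>H\<^esub> g x),
      one = (\<lambda>x\<in>carrier G. \<one>\<^bsub>H\<^esub>)\<rparr>"

text \<open>\<open>Ext\<^sup>1(A,C)\<close> is computed from the standard free resolution
  \<open>0 \<rightarrow> R \<rightarrow> \<int>[A] \<rightarrow> A \<rightarrow> 0\<close>, as the cokernel of the restriction map
  \<open>Hom(\<int>[A],C) \<rightarrow> Hom(R,C)\<close>.\<close>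

definition std_relations :: "('a, 'm) monoid_scheme \<Rightarrow> ('a \<Rightarrow>\<^sub>0 int) monoid" where
  "std_relations A =
     (free_Abelian_group (carrier A))
       \<lparr>carrier := kernel (free_Abelian_group (carrier A)) A (int_comb A)\<rparr>"

definition Ext1 :: "('a, 'm) monoid_scheme \<Rightarrow> ('b, 'n) monoid_scheme \<Rightarrow> (('a \<Rightarrow>\<^sub>0 int) \<Rightarrow> 'b) set monoid" where
  "Ext1 A C =
     hom_group (std_relations A) C Mod
       (\<lambda>f. restrict f (carrier (std_relations A))) ` hom (free_Abelian_group (carrier A)) C"

definition Whitehead :: "('a, 'm) monoid_scheme \<Rightarrow> bool" where
  "Whitehead A \<longleftrightarrow> trivial_group (Ext1 A integer_group)"


section \<open>The ground universe \<open>V\<close>\<close>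

text \<open>\<open>V\<close> is a type whose elements are the sets, with the axioms of ZFC without power set in
  second-order form (choice is inherited from HOL). Power set is left out: nothing below depends on
  it, and without it the sets of hereditary cardinality at most \<open>\<kappa>\<close> form a model, for every
  infinite cardinal \<open>\<kappa>\<close>.\<close>

class set_universe =
  fixes elts :: "'a \<Rightarrow> 'a set"
  assumes extensionality: "elts x = elts y \<Longrightarrow> x = y"
    and foundation: "wf {(x, y). x \<in> elts y}"
    and pairing: "\<exists>z. elts z = {x, y}"
    and union: "\<exists>z. elts z = \<Union> (elts ` elts x)"
    and separation: "X \<subseteq> elts x \<Longrightarrow> \<exists>z. elts z = X"
    and replacement: "\<exists>z. elts z = f ` elts x"
    and infinity: "\<exists>x. infinite (elts x)"

text \<open>\<open>vset X\<close> is the element of \<open>V\<close> with extension \<open>X\<close>; it is meaningful only if \<open>is_set X\<close>.\<close>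

definition is_set :: "'v::set_universe set \<Rightarrow> bool" where
  "is_set X \<longleftrightarrow> (\<exists>x. elts x = X)"

definition vset :: "'v::set_universe set \<Rightarrow> 'v" where
  "vset X = (THE x. elts x = X)"

definition vpair :: "'v::set_universe \<Rightarrow> 'v \<Rightarrow> 'v" where
  "vpair x y = vset {vset {x}, vset {x, y}}"

primrec vnat :: "nat \<Rightarrow> 'v::set_universe" where
  "vnat 0 = vset {}"
| "vnat (Suc n) = vset (insert (vnat n) (elts (vnat n)))"

text \<open>The integer \<open>a - b\<close> with \<open>min a b = 0\<close> is represented by the pair \<open>(a, b)\<close>.\<close>

definition vint :: "int \<Rightarrow> 'v::set_universe" where
  "vint k = vpair (vnat (nat k)) (vnat (nat (- k)))"

definition v_Z :: "'v::set_universe" where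
  "v_Z = vset (range vint)"

definition v_Z_add :: "'v::set_universe" where
  "v_Z_add = vset {vpair (vpair (vint a) (vint b)) (vint (a + b)) | a b. True}"

definition v_Z_abs :: "'v::set_universe" where
  "v_Z_abs = vset {vpair (vint a) (vnat (nat \<bar>a\<bar>)) | a. True}"

definition v_graph :: "'v::set_universe set \<Rightarrow> ('v \<Rightarrow> 'v) \<Rightarrow> 'v" where
  "v_graph X f = vset {vpair x (f x) | x. x \<in> X}"

definition v_mult :: "('v::set_universe) monoid \<Rightarrow> 'v" where
  "v_mult G = vset {vpair (vpair x y) (x \<otimes>\<^bsub>G\<^esub> y) | x y. x \<in> carrier G \<and> y \<in> carrier G}"


section \<open>The Boolean-valued universe \<open>V\<^sup>\<bool>\<close>\<close>

text \<open>Complete Boolean algebras are types of sort \<open>{complete_lattice, boolean_algebra}\<close>. The class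
  \<open>complete_boolean_algebra\<close> of the library is deliberately avoided: it demands complete
  distributivity and so only admits atomic algebras.

  \<open>BName D N p\<close> is the name \<open>{(N i, p i) | i \<in> D}\<close>, for a set \<open>D\<close> of \<open>V\<close>. Values of \<open>N\<close> and \<open>p\<close>
  outside \<open>D\<close> are irrelevant. The constructor \<open>BEmpty\<close> (the empty name) starts the recursion.\<close>

datatype ('v, 'b) bname = BEmpty | BName 'v "'v \<Rightarrow> ('v, 'b) bname" "'v \<Rightarrow> 'b"

primrec bindex :: "('v::set_universe, 'b) bname \<Rightarrow> 'v set" where
  "bindex BEmpty = {}"
| "bindex (BName D N p) = elts D"

primrec bmember :: "('v, 'b) bname \<Rightarrow> 'v \<Rightarrow> ('v, 'b) bname" where
  "bmember BEmpty = (\<lambda>i. BEmpty)"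
| "bmember (BName D N p) = N"

primrec bweight :: "('v, 'b::bot) bname \<Rightarrow> 'v \<Rightarrow> 'b" where
  "bweight BEmpty = (\<lambda>i. bot_class.bot)"
| "bweight (BName D N p) = p"

text \<open>Bold logical symbols are the Boolean-valued connectives and quantifiers; the quantifiers
  range over all of \<open>V\<^sup>\<bool>\<close>.\<close>

notation inf_class.inf (infixr \<open>\<^bold>\<and>\<close> 35)
notation sup_class.sup (infixr \<open>\<^bold>\<or>\<close> 30)
notation uminus (\<open>\<^bold>\<not> _\<close> [40] 40)

definition bimp :: "'b::boolean_algebra \<Rightarrow> 'b \<Rightarrow> 'b" (infixr \<open>\<^bold>\<longrightarrow>\<close> 25) where
  "(a \<^bold>\<longrightarrow> b) = (\<^bold>\<not> a \<^bold>\<or> b)"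

definition biff :: "'b::boolean_algebra \<Rightarrow> 'b \<Rightarrow> 'b" (infixr \<open>\<^bold>\<longleftrightarrow>\<close> 25) where
  "(a \<^bold>\<longleftrightarrow> b) = ((a \<^bold>\<longrightarrow> b) \<^bold>\<and> (b \<^bold>\<longrightarrow> a))"

definition b_all :: "(('v, 'b) bname \<Rightarrow> 'b::complete_lattice) \<Rightarrow> 'b" (binder \<open>\<^bold>\<forall>\<close> 10) where
  "(\<^bold>\<forall>x. \<phi> x) = (INF x. \<phi> x)"

definition b_ex :: "(('v, 'b) bname \<Rightarrow> 'b::complete_lattice) \<Rightarrow> 'b" (binder \<open>\<^bold>\<exists>\<close> 10) where
  "(\<^bold>\<exists>x. \<phi> x) = (SUP x. \<phi> x)"

text \<open>Boolean value of \<open>u = v\<close>, with the values of the two inclusions written out so that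
  the recursion is structural in \<open>u\<close>; lemma \<open>beq_iff_subsets\<close> gives the usual form.\<close>

primrec beq :: "('v::set_universe, 'b::{complete_lattice, boolean_algebra}) bname
    \<Rightarrow> ('v, 'b) bname \<Rightarrow> 'b" (infix \<open>\<^bold>=\<close> 50) where
  "beq BEmpty = (\<lambda>v. INF j \<in> bindex v. \<^bold>\<not> bweight v j)"
| "beq (BName D N p) = (\<lambda>v.
     (INF i \<in> elts D. p i \<^bold>\<longrightarrow> (SUP j \<in> bindex v. bweight v j \<^bold>\<and> beq (N i) (bmember v j))) \<^bold>\<and>
     (INF j \<in> bindex v. bweight v j \<^bold>\<longrightarrow> (SUP i \<in> elts D. p i \<^bold>\<and> beq (N i) (bmember v j))))"

definition bmem :: "('v::set_universe, 'b::{complete_lattice, boolean_algebra}) bname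
    \<Rightarrow> ('v, 'b) bname \<Rightarrow> 'b" (infix \<open>\<^bold>\<in>\<close> 50) where
  "(u \<^bold>\<in> v) = (SUP j \<in> bindex v. bweight v j \<^bold>\<and> (u \<^bold>= bmember v j))"

lemma beq_sym: "(u \<^bold>= v) = (v \<^bold>= u)"
proof (induction u arbitrary: v)
  case BEmpty
  show ?case by (cases v) (simp_all add: bimp_def)
next
  case (BName D N p)
  show ?case
    by (cases v) (simp_all add: bimp_def BName.IH[OF rangeI] Lattices.inf_commute)
qed

lemma beq_iff_subsets:
  "(u \<^bold>= v) =
     ((INF i \<in> bindex u. bweight u i \<^bold>\<longrightarrow> (bmember u i \<^bold>\<in> v)) \<^bold>\<and>
      (INF j \<in> bindex v. bweight v j \<^bold>\<longrightarrow> (bmember v j \<^bold>\<in> u)))"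
  by (cases u) (simp_all add: bmem_def bimp_def beq_sym[of "bmember v _"])

text \<open>The canonical name \<open>x\<close>-check of \<open>x \<in> V\<close>. The conditional only serves well-foundedness.\<close>

function check :: "'v::set_universe \<Rightarrow> ('v, 'b::{complete_lattice, boolean_algebra}) bname" where
  "check x = BName x (\<lambda>y. if y \<in> elts x then check y else BEmpty) (\<lambda>y. top_class.top)"
  by auto
termination
  by (relation "{(x, y). x \<in> elts y}") (simp_all add: foundation)

declare check.simps [simp del]


section \<open>Formulas of set theory in \<open>V\<^sup>\<bool>\<close>\<close>

text \<open>\<open>b_upair z x y\<close> says \<open>z = {x, y}\<close>, and \<open>b_pair p x y\<close> says that \<open>p\<close> is the Kuratowski
  pair of \<open>x\<close> and \<open>y\<close>.\<close>

definition b_upair :: "('v::set_universe, 'b::{complete_lattice, boolean_algebra}) bname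
    \<Rightarrow> ('v, 'b) bname \<Rightarrow> ('v, 'b) bname \<Rightarrow> 'b" where
  "b_upair z x y = (\<^bold>\<forall>w. (w \<^bold>\<in> z) \<^bold>\<longleftrightarrow> ((w \<^bold>= x) \<^bold>\<or> (w \<^bold>= y)))"

definition b_pair :: "('v::set_universe, 'b::{complete_lattice, boolean_algebra}) bname
    \<Rightarrow> ('v, 'b) bname \<Rightarrow> ('v, 'b) bname \<Rightarrow> 'b" where
  "b_pair p x y = (\<^bold>\<forall>z. (z \<^bold>\<in> p) \<^bold>\<longleftrightarrow> (b_upair z x x \<^bold>\<or> b_upair z x y))"

definition b_pair_in :: "('v::set_universe, 'b::{complete_lattice, boolean_algebra}) bname
    \<Rightarrow> ('v, 'b) bname \<Rightarrow> ('v, 'b) bname \<Rightarrow> 'b" where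
  "b_pair_in x y r = (\<^bold>\<exists>p. b_pair p x y \<^bold>\<and> (p \<^bold>\<in> r))"

definition b_triple_in :: "('v::set_universe, 'b::{complete_lattice, boolean_algebra}) bname
    \<Rightarrow> ('v, 'b) bname \<Rightarrow> ('v, 'b) bname \<Rightarrow> ('v, 'b) bname \<Rightarrow> 'b" where
  "b_triple_in x y z r = (\<^bold>\<exists>q. b_pair q x y \<^bold>\<and> b_pair_in q z r)"

text \<open>\<open>f\<close> is a function from \<open>X\<close> to \<open>Y\<close>.\<close>

definition b_function :: "('v::set_universe, 'b::{complete_lattice, boolean_algebra}) bname
    \<Rightarrow> ('v, 'b) bname \<Rightarrow> ('v, 'b) bname \<Rightarrow> 'b" where
  "b_function f X Y =
     ((\<^bold>\<forall>p. (p \<^bold>\<in> f) \<^bold>\<longrightarrow> (\<^bold>\<exists>x. \<^bold>\<exists>y. (x \<^bold>\<in> X) \<^bold>\<and> (y \<^bold>\<in> Y) \<^bold>\<and> b_pair p x y)) \<^bold>\<and>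
      (\<^bold>\<forall>x. (x \<^bold>\<in> X) \<^bold>\<longrightarrow> (\<^bold>\<exists>y. (y \<^bold>\<in> Y) \<^bold>\<and> b_pair_in x y f)) \<^bold>\<and>
      (\<^bold>\<forall>x. \<^bold>\<forall>y. \<^bold>\<forall>y'. b_pair_in x y f \<^bold>\<and> b_pair_in x y' f \<^bold>\<longrightarrow> (y \<^bold>= y')))"

text \<open>\<open>f\<close> is a homomorphism from \<open>X\<close> to \<open>Y\<close>, where \<open>mX\<close> and \<open>mY\<close> are the group operations.\<close>

definition b_hom :: "('v::set_universe, 'b::{complete_lattice, boolean_algebra}) bname
    \<Rightarrow> ('v, 'b) bname \<Rightarrow> ('v, 'b) bname \<Rightarrow> ('v, 'b) bname \<Rightarrow> ('v, 'b) bname \<Rightarrow> 'b" where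
  "b_hom f X mX Y mY =
     (b_function f X Y \<^bold>\<and>
      (\<^bold>\<forall>x. \<^bold>\<forall>x'. \<^bold>\<forall>x''. \<^bold>\<forall>y. \<^bold>\<forall>y'. \<^bold>\<forall>y''.
         b_triple_in x x' x'' mX \<^bold>\<and> b_pair_in x y f \<^bold>\<and> b_pair_in x' y' f \<^bold>\<and>
         b_triple_in y y' y'' mY \<^bold>\<longrightarrow> b_pair_in x'' y'' f))"

text \<open>\<open>g\<close> is the restriction of \<open>f\<close> to \<open>X\<close>.\<close>

definition b_restriction :: "('v::set_universe, 'b::{complete_lattice, boolean_algebra}) bname
    \<Rightarrow> ('v, 'b) bname \<Rightarrow> ('v, 'b) bname \<Rightarrow> 'b" where
  "b_restriction f X g =
     (\<^bold>\<forall>p. (p \<^bold>\<in> g) \<^bold>\<longleftrightarrow> ((p \<^bold>\<in> f) \<^bold>\<and> (\<^bold>\<exists>x. \<^bold>\<exists>y. (x \<^bold>\<in> X) \<^bold>\<and> b_pair p x y)))"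

text \<open>\<open>|f(y)| \<le> e(y)\<close> for all \<open>y \<in> S\<close>. On \<open>\<omega>\<close>, \<open>m \<le> k\<close> means \<open>m \<in> k \<or> m = k\<close>.\<close>

definition b_abs_bounded :: "('v::set_universe, 'b::{complete_lattice, boolean_algebra}) bname
    \<Rightarrow> ('v, 'b) bname \<Rightarrow> ('v, 'b) bname \<Rightarrow> ('v, 'b) bname \<Rightarrow> 'b" where
  "b_abs_bounded f absZ e S =
     (\<^bold>\<forall>y. \<^bold>\<forall>n. \<^bold>\<forall>m. \<^bold>\<forall>k. (y \<^bold>\<in> S) \<^bold>\<and> b_pair_in y n f \<^bold>\<and> b_pair_in n m absZ \<^bold>\<and> b_pair_in y k e
        \<^bold>\<longrightarrow> ((m \<^bold>\<in> k) \<^bold>\<or> (m \<^bold>= k)))"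

end

theory Submission
  imports Defs
begin

text \<open>If some \<open>\<sigma>\<close> has the three properties with Boolean value \<open>c \<noteq> 0\<close>, take an ultrafilter \<open>U\<close> of
  the Boolean algebra, in general not generic, with \<open>c \<in> U\<close>. For a basis element \<open>y\<close> only the
  finitely many values \<open>n\<close> with \<open>\<bar>n\<bar> \<le> e(y)\<close> are possible, so the value of \<open>\<sigma>(y) = n\<close> lies in
  \<open>U\<close> for exactly one \<open>n\<close>. The elements of \<open>F\<close> at which \<open>U\<close> decides \<open>\<sigma>\<close> form a subgroup, hence
  all of \<open>F\<close>, and the decided values form a homomorphism in \<open>V\<close> that extends \<open>\<tau>\<close>. No fullness or
  mixing of names is needed.\<close>

section \<open>Boolean algebras and ultrafilters\<close>

context boolean_algebra
begin

definition proper_filter :: "'a set \<Rightarrow> bool" where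
  "proper_filter U \<longleftrightarrow> top \<in> U \<and> bot \<notin> U \<and> (\<forall>x\<in>U. \<forall>y. x \<le> y \<longrightarrow> y \<in> U) \<and>
     (\<forall>x\<in>U. \<forall>y\<in>U. inf x y \<in> U)"

definition ultrafilter_on_algebra :: "'a set \<Rightarrow> bool" where
  "ultrafilter_on_algebra U \<longleftrightarrow> proper_filter U \<and> (\<forall>x. x \<in> U \<or> - x \<in> U)"

lemma proper_filter_Union_chain:
  assumes "subset.chain {U. proper_filter U} C" "C \<noteq> {}"
  shows "proper_filter (\<Union>C)"
proof -
  have pf: "proper_filter U" if "U \<in> C" for U
    using assms(1) that by (auto simp: subset_chain_def)
  have inf: "inf x y \<in> \<Union>C" if xy: "x \<in> U" "U \<in> C" "y \<in> W" "W \<in> C" for x y U W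
  proof (cases "U \<subseteq> W")
    case True
    then show ?thesis using xy pf[of W] unfolding proper_filter_def by blast
  next
    case False
    then have "W \<subseteq> U" using assms(1) xy by (auto simp: subset_chain_def)
    then show ?thesis using xy pf[of U] unfolding proper_filter_def by blast
  qed
  show ?thesis
    unfolding proper_filter_def
  proof (intro conjI ballI allI impI)
    show "top \<in> \<Union>C" using assms(2) pf by (auto simp: proper_filter_def)
    show "bot \<notin> \<Union>C" using pf by (auto simp: proper_filter_def)
    show "y \<in> \<Union>C" if "x \<in> \<Union>C" "x \<le> y" for x y
      using that pf unfolding proper_filter_def by blast
    show "inf x y \<in> \<Union>C" if "x \<in> \<Union>C" "y \<in> \<Union>C" for x y
      using that inf by blast
  qed
qed

text \<open>This is the filter generated by \<open>U\<close> and \<open>x\<close>. It is proper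
  because a meet of \<open>x\<close> with some \<open>u\<close> in \<open>U\<close> can vanish only
  if \<open>u\<close> lies below \<open>- x\<close>, which would put \<open>- x\<close> into
  \<open>U\<close>.\<close>

lemma proper_filter_generate:
  assumes U: "proper_filter U" and x: "- x \<notin> U"
  shows "proper_filter {z. \<exists>u\<in>U. inf u x \<le> z}"
  unfolding proper_filter_def
proof (intro conjI ballI allI impI)
  show "top \<in> {z. \<exists>u\<in>U. inf u x \<le> z}"
    using U by (auto simp: proper_filter_def)
  have "u \<le> - x" if "inf u x \<le> bot" for u
    using that by (simp add: shunt1)
  then show "bot \<notin> {z. \<exists>u\<in>U. inf u x \<le> z}"
    using U x unfolding proper_filter_def by blast
  show "y \<in> {z. \<exists>u\<in>U. inf u x \<le> z}" if "a \<in> {z. \<exists>u\<in>U. inf u x \<le> z}" "a \<le> y" for a y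
    using that order_trans by blast
  show "inf a b \<in> {z. \<exists>u\<in>U. inf u x \<le> z}"
    if ab: "a \<in> {z. \<exists>u\<in>U. inf u x \<le> z}" "b \<in> {z. \<exists>u\<in>U. inf u x \<le> z}" for a b
  proof -
    obtain u w where uw: "u \<in> U" "w \<in> U" "inf u x \<le> a" "inf w x \<le> b"
      using ab by auto
    have "inf (inf u w) x \<le> a"
      by (rule order_trans[OF _ uw(3)]) (simp add: le_infI1)
    moreover have "inf (inf u w) x \<le> b"
      by (rule order_trans[OF _ uw(4)]) (simp add: le_infI1)
    moreover have "inf u w \<in> U"
      using U uw by (auto simp: proper_filter_def)
    ultimately show ?thesis by (intro CollectI bexI[of _ "inf u w"] le_infI)
  qed
qed

text \<open>Zorn's lemma for the proper filters containing \<open>c\<close>, which start with the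
  principal one. If a maximal filter omitted both \<open>x\<close> and \<open>- x\<close>, adjoining
  \<open>x\<close> would enlarge it.\<close>

lemma ex_ultrafilter_on_algebra:
  assumes "c \<noteq> bot"
  obtains U where "ultrafilter_on_algebra U" "c \<in> U"
proof -
  let ?A = "{U. proper_filter U}"
  let ?P = "{z. c \<le> z}"
  have P: "proper_filter ?P"
    using assms by (simp add: proper_filter_def bot_unique) (meson order_trans)
  have "\<exists>M\<in>{U. proper_filter U \<and> c \<in> U}. \<forall>X\<in>{U. proper_filter U \<and> c \<in> U}. M \<subseteq> X \<longrightarrow> X = M"
  proof (rule subset_Zorn_nonempty)
    show "{U. proper_filter U \<and> c \<in> U} \<noteq> {}" using P by blast
    fix C assume C: "C \<noteq> {}" "subset.chain {U. proper_filter U \<and> c \<in> U} C"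
    then have "subset.chain ?A C" by (auto simp: subset_chain_def)
    then show "\<Union>C \<in> {U. proper_filter U \<and> c \<in> U}"
      using C proper_filter_Union_chain[of C] by (auto simp: subset_chain_def)
  qed
  then obtain U where U: "proper_filter U" "c \<in> U"
    and max: "\<And>X. \<lbrakk>proper_filter X; c \<in> X; U \<subseteq> X\<rbrakk> \<Longrightarrow> X = U"
    by auto
  have "x \<in> U" if "- x \<notin> U" for x
  proof -
    let ?X = "{z. \<exists>u\<in>U. inf u x \<le> z}"
    have sub: "U \<subseteq> ?X" using inf_le1 by blast
    then have "?X = U"
      using max[OF proper_filter_generate[OF U(1) that]] U(2) by blast
    moreover have "x \<in> ?X" using U(2) by (auto intro!: bexI[of _ c])
    ultimately show ?thesis by blast
  qed
  then show ?thesis using that[of U] U by (auto simp: ultrafilter_on_algebra_def)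
qed

lemma ultrafilter_on_algebra_sup:
  assumes U: "ultrafilter_on_algebra U" and "sup x y \<in> U"
  shows "x \<in> U \<or> y \<in> U"
proof (rule ccontr)
  assume "\<not> (x \<in> U \<or> y \<in> U)"
  then have "- x \<in> U" "- y \<in> U" using U by (auto simp: ultrafilter_on_algebra_def)
  then have "inf (sup x y) (inf (- x) (- y)) \<in> U"
    using U assms(2) by (auto simp: ultrafilter_on_algebra_def proper_filter_def)
  moreover have "inf (sup x y) (inf (- x) (- y)) = bot"
    using inf_compl_bot[of "sup x y"] by simp
  ultimately show False using U by (simp add: ultrafilter_on_algebra_def proper_filter_def)
qed

end

text \<open>An ultrafilter respects finite joins but in general not infinite ones. The bound
  \<open>e\<close> on the basis is what makes the joins finite.\<close>

lemma ultrafilter_on_algebra_finite_SUP: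
  fixes f :: "'i \<Rightarrow> 'b::{complete_lattice, boolean_algebra}"
  assumes U: "ultrafilter_on_algebra U" and "finite I" "(SUP i\<in>I. f i) \<in> U"
  shows "\<exists>i\<in>I. f i \<in> U"
  using assms(2,3)
proof (induction I)
  case empty
  then show ?case using U by (auto simp: ultrafilter_on_algebra_def proper_filter_def)
next
  case (insert i I)
  then show ?case using ultrafilter_on_algebra_sup[OF U] by fastforce
qed

text \<open>Every Boolean algebra is a Heyting algebra, so binary meets distribute over arbitrary joins,
  although the library states this only for completely distributive algebras.\<close>

lemma ba_le_SUP_E:
  fixes f :: "'i \<Rightarrow> 'b::{complete_lattice, boolean_algebra}"
  assumes "a \<le> (SUP i\<in>I. f i)" and "\<And>i d. i \<in> I \<Longrightarrow> d \<le> a \<Longrightarrow> d \<le> f i \<Longrightarrow> d \<le> b"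
  shows "a \<le> b"
proof -
  \<comment> \<open>The Heyting implication from \<open>a\<close> to \<open>b\<close> bounds each
    \<open>f i\<close>, hence their join. It lies above \<open>a\<close> for that reason, and
    meeting with \<open>a\<close> gives \<open>b\<close>.\<close>
  have "f i \<le> (\<^bold>\<not> a \<^bold>\<or> b)" if "i \<in> I" for i
    using assms(2)[OF that, of "inf a (f i)"] shunt1[of "f i" a b] by (simp add: inf_commute)
  then have "(SUP i\<in>I. f i) \<le> (\<^bold>\<not> a \<^bold>\<or> b)" by (rule SUP_least)
  with assms(1) have "a \<le> (\<^bold>\<not> a \<^bold>\<or> b)" by (rule order_trans)
  then have "inf a a \<le> b" by (subst shunt1)
  then show ?thesis by simp
qed

section \<open>Rules for connectives and quantifiers below a fixed condition
  \<open>d\<close>\<close>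

lemma le_bimp_iff:
  fixes a :: "'b::boolean_algebra"
  shows "d \<le> (a \<^bold>\<longrightarrow> b) \<longleftrightarrow> (d \<^bold>\<and> a) \<le> b"
  by (simp add: bimp_def shunt1)

lemma le_bimpD:
  fixes a :: "'b::boolean_algebra"
  assumes "d \<le> (a \<^bold>\<longrightarrow> b)" "d \<le> a"
  shows "d \<le> b"
  using assms by (metis le_bimp_iff inf_absorb1)

text \<open>Equivalences below \<open>d\<close> become equations between meets with
  \<open>d\<close>, so that distributivity can rewrite inside joins; the congruence rules for pairs
  are proved in this way.\<close>

lemma le_biff_iff:
  fixes a :: "'b::boolean_algebra"
  shows "d \<le> (a \<^bold>\<longleftrightarrow> b) \<longleftrightarrow> (d \<^bold>\<and> a) = (d \<^bold>\<and> b)"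
proof -
  have "d \<le> (a \<^bold>\<longleftrightarrow> b) \<longleftrightarrow> inf d a \<le> inf d b \<and> inf d b \<le> inf d a"
    by (simp add: biff_def le_bimp_iff)
  then show ?thesis by (simp only: order_eq_iff)
qed

lemma le_b_all_iff: "d \<le> (\<^bold>\<forall>x. \<phi> x) \<longleftrightarrow> (\<forall>x. d \<le> \<phi> x)"
  by (simp add: b_all_def le_INF_iff)

lemma b_all_lower: "(\<^bold>\<forall>x. \<phi> x) \<le> \<phi> x"
  by (simp add: le_b_all_iff[of "b_all \<phi>" \<phi>, THEN iffD1])

lemma le_b_ex_I: "d \<le> \<phi> x \<Longrightarrow> d \<le> (\<^bold>\<exists>x. \<phi> x)"
  unfolding b_ex_def by (rule SUP_upper2[OF UNIV_I])

text \<open>This takes the place of choosing a witness: no single name has to attain the join, since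
  the condition may shrink together with the choice of \<open>x\<close>.\<close>

lemma le_b_ex_E:
  fixes \<phi> :: "('v, 'b) bname \<Rightarrow> 'b::{complete_lattice, boolean_algebra}"
  assumes "a \<le> (\<^bold>\<exists>x. \<phi> x)" and "\<And>x d. d \<le> a \<Longrightarrow> d \<le> \<phi> x \<Longrightarrow> d \<le> b"
  shows "a \<le> b"
  by (rule ba_le_SUP_E[OF assms(1)[unfolded b_ex_def]]) (rule assms(2))


section \<open>Extracting a homomorphism from Boolean values\<close>

text \<open>Surjectivity of \<open>int_comb\<close> writes each element as a finite product of
  integer powers of elements of \<open>S\<close>, and induction on the support keeps such a product
  in \<open>H\<close>.\<close>

lemma (in comm_group) basis_generates:
  assumes basis: "is_basis G S" and H: "subgroup H G" "S \<subseteq> H"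
  shows "H = carrier G"
proof
  show "H \<subseteq> carrier G" using H by (simp add: subgroup.subset)
  show "carrier G \<subseteq> H"
  proof
    fix x assume "x \<in> carrier G"
    then have "x \<in> int_comb G ` carrier (free_Abelian_group S)"
      using basis by (simp add: is_basis_def iso_def bij_betw_def)
    then obtain c where c: "Poly_Mapping.keys c \<subseteq> S" "x = int_comb G c"
      by (auto simp: free_Abelian_group_def)
    have "finprod G (\<lambda>x. x [^] Poly_Mapping.lookup c x) T \<in> H" if "T \<subseteq> S" "finite T" for T
      using that(2,1)
    proof (induction T)
      case empty
      then show ?case using H by (simp add: subgroup.one_closed)
    next
      case (insert y T)
      have "y [^] Poly_Mapping.lookup c y \<in> H"
        using insert.prems H by (auto intro: subgroup_int_pow_closed)
      moreover have "(\<lambda>x. x [^] Poly_Mapping.lookup c x) \<in> insert y T \<rightarrow> carrier G"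
        using insert.prems H subgroup.subset[OF H(1)] by auto
      ultimately show ?case
        using insert H by (simp add: subgroup.m_closed Pi_iff)
    qed
    then show "x \<in> H" using c by (simp add: int_comb_def)
  qed
qed

text \<open>Read \<open>P x n\<close> as the Boolean value of \<open>\<sigma>(x) = n\<close>.\<close>

lemma (in comm_group) hom_from_boolean_values:
  fixes P :: "'a \<Rightarrow> int \<Rightarrow> 'c::{complete_lattice, boolean_algebra}"
    and e :: "'a \<Rightarrow> nat"
  assumes basis: "is_basis G S"
    and c: "c \<noteq> bot_class.bot"
    and total: "\<And>x. x \<in> carrier G \<Longrightarrow> c \<le> (SUP n. P x n)"
    and unique: "\<And>x m n d. \<lbrakk>x \<in> carrier G; d \<le> c; d \<le> P x m; d \<le> P x n; m \<noteq> n\<rbrakk> \<Longrightarrow> d = bot_class.bot"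
    and add: "\<And>x y m n d. \<lbrakk>x \<in> carrier G; y \<in> carrier G; d \<le> c; d \<le> P x m; d \<le> P y n\<rbrakk>
                \<Longrightarrow> d \<le> P (x \<otimes> y) (m + n)"
    and bounded: "\<And>y n d. \<lbrakk>y \<in> S; d \<le> c; d \<le> P y n; \<not> \<bar>n\<bar> \<le> int (e y)\<rbrakk> \<Longrightarrow> d = bot_class.bot"
  shows "\<exists>s\<in>hom G integer_group. \<forall>x\<in>carrier G. \<forall>n. c \<le> P x n \<longrightarrow> s x = n"
proof -
  obtain U where U: "ultrafilter_on_algebra U" "c \<in> U"
    using ex_ultrafilter_on_algebra[OF c] .
  have up: "y \<in> U" if "x \<in> U" "x \<le> y" for x y
    using U that by (auto simp: ultrafilter_on_algebra_def proper_filter_def)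
  have inf: "inf x y \<in> U" if "x \<in> U" "y \<in> U" for x y
    using U that by (auto simp: ultrafilter_on_algebra_def proper_filter_def)
  have bot: "bot_class.bot \<notin> U"
    using U by (auto simp: ultrafilter_on_algebra_def proper_filter_def)
  have S: "S \<subseteq> carrier G" using basis by (simp add: is_basis_def)
  have U_unique: "m = n" if x: "x \<in> carrier G" and P: "P x m \<in> U" "P x n \<in> U" for x m n
  proof (rule ccontr)
    assume "m \<noteq> n"
    \<comment> \<open>The hypotheses on \<open>P\<close> speak only about conditions below
      \<open>c\<close>, hence the extra meet; it stays in \<open>U\<close> because \<open>c\<close>
      does.\<close>
    then have "inf c (inf (P x m) (P x n)) = bot_class.bot"
      by (intro unique[OF x]) (auto intro: le_infI2)
    then show False using inf[OF U(2) inf[OF P]] bot by simp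
  qed
  have U_add: "P (x \<otimes> y) (m + n) \<in> U"
    if xy: "x \<in> carrier G" "y \<in> carrier G" and P: "P x m \<in> U" "P y n \<in> U" for x y m n
    by (rule up[OF inf[OF U(2) inf[OF P]]], rule add[OF xy]) (auto intro: le_infI2)
  \<comment> \<open>If \<open>n\<close> is the value at the identity, then so is
    \<open>n + n\<close>, and uniqueness leaves only \<open>n = 0\<close>.\<close>
  have P_one: "c \<le> P \<one> 0"
  proof (rule ba_le_SUP_E[OF total[OF one_closed]])
    fix n d assume d: "d \<le> c" "d \<le> P \<one> n"
    show "d \<le> P \<one> 0"
    proof (cases "n = 0")
      case False
      have "d \<le> P \<one> (n + n)" using add[OF one_closed one_closed d d(2)] by simp
      then have "d = bot_class.bot" using unique[OF one_closed d] False by auto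
      then show ?thesis by simp
    qed (use d in simp)
  qed
  \<comment> \<open>Any value \<open>m\<close> at the inverse gives the value \<open>n + m\<close>
    at the identity, which must be \<open>0\<close>.\<close>
  have P_inv: "inf c (P x n) \<le> P (inv x) (- n)" if x: "x \<in> carrier G" for x n
  proof (rule ba_le_SUP_E)
    show "inf c (P x n) \<le> (SUP m. P (inv x) m)"
      using total[OF inv_closed[OF x]] by (rule le_infI1)
    fix m d assume d: "d \<le> inf c (P x n)" "d \<le> P (inv x) m"
    show "d \<le> P (inv x) (- n)"
    proof (cases "m = - n")
      case False
      have "d \<le> P \<one> (n + m)"
        using add[OF x inv_closed[OF x], of d n m] d x by simp
      then have "d = bot_class.bot"
        using unique[OF one_closed, of d 0 "n + m"] d order_trans[OF _ P_one, of d] False by auto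
      then show ?thesis by simp
    qed (use d in simp)
  qed
  \<comment> \<open>\<open>total\<close> puts the join over all integers into \<open>U\<close>, but
    this does not put any single \<open>P x n\<close> there. So membership in \<open>H\<close> is
    shown directly for basis elements and then spread by the subgroup property.\<close>
  define H where "H = {x \<in> carrier G. \<exists>n. P x n \<in> U}"
  have "subgroup H G"
  proof (rule subgroupI)
    show "H \<subseteq> carrier G" by (auto simp: H_def)
    show "H \<noteq> {}" using up[OF U(2) P_one] by (auto simp: H_def)
    show "inv x \<in> H" if "x \<in> H" for x
      using that P_inv up inf U(2) unfolding H_def by blast
    show "x \<otimes> y \<in> H" if "x \<in> H" "y \<in> H" for x y
      using that U_add unfolding H_def by blast
  qed
  moreover have "S \<subseteq> H"
  proof
    fix y assume y: "y \<in> S"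
    then have yG: "y \<in> carrier G" using S by auto
    let ?I = "{- int (e y)..int (e y)}"
    \<comment> \<open>Values outside the interval contribute nothing below \<open>c\<close>, so the
      infinite join shrinks to a finite one, to which the ultrafilter property applies.\<close>
    have "c \<le> (SUP n\<in>?I. P y n)"
    proof (rule ba_le_SUP_E[OF total[OF yG]])
      fix n d assume d: "d \<le> c" "d \<le> P y n"
      show "d \<le> (SUP n\<in>?I. P y n)"
      proof (cases "\<bar>n\<bar> \<le> int (e y)")
        case True
        then show ?thesis using d by (intro SUP_upper2[of n]) auto
      next
        case False
        then show ?thesis using bounded[OF y d] by simp
      qed
    qed
    then have "(SUP n\<in>?I. P y n) \<in> U" using up U(2) by blast
    then show "y \<in> H"
      using ultrafilter_on_algebra_finite_SUP[OF U(1)] yG by (auto simp: H_def)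
  qed
  ultimately have H: "H = carrier G" by (rule basis_generates[OF basis])
  define s where "s x = (THE n. P x n \<in> U)" for x
  have s_eq: "s x = n" if "x \<in> carrier G" "P x n \<in> U" for x n
    unfolding s_def using that U_unique by blast
  have s: "P x (s x) \<in> U" if "x \<in> carrier G" for x
    using that H s_eq unfolding H_def by auto
  show ?thesis
  proof (intro bexI ballI allI impI)
    show "s \<in> hom G integer_group"
      by (auto simp: hom_def integer_group_def intro!: s_eq U_add s)
    show "s x = n" if "x \<in> carrier G" "c \<le> P x n" for x n
      using s_eq up U(2) that by blast
  qed
qed


section \<open>Sets of the ground universe\<close>

lemma elts_vset: "is_set X \<Longrightarrow> elts (vset X) = X"
proof -
  assume "is_set X"
  then obtain x where x: "elts x = X" by (auto simp: is_set_def)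
  then have "vset X = x" unfolding vset_def by (intro the_equality) (auto intro: extensionality)
  then show ?thesis using x by simp
qed

lemma is_set_elts [simp]: "is_set (elts x)"
  by (auto simp: is_set_def)

lemma is_set_subset: "is_set Y \<Longrightarrow> X \<subseteq> Y \<Longrightarrow> is_set X"
  by (auto simp: is_set_def intro: separation)

lemma is_set_image: "is_set X \<Longrightarrow> is_set (f ` X)" for f :: "'v::set_universe \<Rightarrow> 'v"
  by (auto simp: is_set_def intro: replacement)

lemma is_set_UN:
  fixes f :: "'v::set_universe \<Rightarrow> 'v set"
  assumes "is_set X" "\<And>x. x \<in> X \<Longrightarrow> is_set (f x)"
  shows "is_set (\<Union>x\<in>X. f x)"
proof -
  \<comment> \<open>Replacement acts on functions with values in the universe, so each
    \<open>f x\<close> is first coded by its set; the union axiom then removes the coding.\<close>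
  obtain z where z: "elts z = (\<lambda>x. vset (f x)) ` X"
    using is_set_image[OF assms(1), of "\<lambda>x. vset (f x)"] by (auto simp: is_set_def)
  have "(\<Union>x\<in>X. f x) = \<Union> (elts ` elts z)"
    using assms(2) by (simp add: z image_image elts_vset)
  then show ?thesis using union[of z] by (auto simp: is_set_def)
qed

text \<open>The axiom of infinity supplies some infinite set. An injective sequence in it has a
  range that is a set by separation, and replacement carries this range onto \<open>X\<close>.
  Pairs, numerals and the integers with their operations become sets in this way.\<close>

lemma is_set_countable:
  fixes X :: "'v::set_universe set"
  assumes "countable X"
  shows "is_set X"
proof -
  obtain x :: 'v where x: "infinite (elts x)" using infinity by blast
  show ?thesis
  proof (cases "X = {}")
    case True
    then show ?thesis using is_set_subset[OF is_set_elts, of "{}" x] by simp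
  next
    case False
    then obtain f :: "nat \<Rightarrow> 'v" where f: "X = range f"
      using assms by (metis uncountable_def)
    obtain g :: "nat \<Rightarrow> 'v" where g: "inj g" "range g \<subseteq> elts x"
      using x infinite_countable_subset by blast
    have "X = (f \<circ> inv_into UNIV g) ` range g"
      using g f by (simp add: image_image)
    moreover have "is_set (range g)" using is_set_subset[OF is_set_elts g(2)] .
    ultimately show ?thesis using is_set_image by metis
  qed
qed

section \<open>Pairs, numerals, integers and graphs as ground sets\<close>

lemma elts_vset_upair [simp]: "elts (vset {x, y}) = {x, y}"
  by (simp add: elts_vset is_set_countable)

lemma elts_vset_singleton [simp]: "elts (vset {x}) = {x}"
  using elts_vset_upair[of x x] by simp

lemma elts_vpair: "elts (vpair x y) = {vset {x}, vset {x, y}}"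
  by (simp add: vpair_def)

lemma vpair_eq_iff [simp]: "vpair x y = vpair x' y' \<longleftrightarrow> x = x' \<and> y = y'"
proof
  assume "vpair x y = vpair x' y'"
  then have "{vset {x}, vset {x, y}} = {vset {x'}, vset {x', y'}}"
    by (metis elts_vpair)
  \<comment> \<open>Passing to extensions turns both Kuratowski pairs into sets of sets in HOL,
    where the usual case distinction finishes.\<close>
  then have "elts ` {vset {x}, vset {x, y}} = elts ` {vset {x'}, vset {x', y'}}"
    by simp
  then have "{{x}, {x, y}} = {{x'}, {x', y'}}" by simp
  then show "x = x' \<and> y = y'" by (auto simp: doubleton_eq_iff)
qed simp

lemma elts_vnat: "elts (vnat n :: 'v::set_universe) = vnat ` {..<n}"
proof (induction n)
  case 0
  show ?case by (simp add: elts_vset is_set_countable)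
next
  case (Suc n)
  have "countable (insert (vnat n :: 'v) (elts (vnat n)))" by (simp add: Suc)
  then have "elts (vnat (Suc n) :: 'v) = insert (vnat n) (elts (vnat n))"
    by (simp add: elts_vset is_set_countable)
  then show ?case by (simp add: Suc lessThan_Suc)
qed

lemma not_mem_self: "x \<notin> elts x" for x :: "'v::set_universe"
  using wf_not_refl[OF foundation, of x] by simp

lemma vnat_eq_iff [simp]: "(vnat m :: 'v::set_universe) = vnat n \<longleftrightarrow> m = n"
proof -
  \<comment> \<open>A smaller numeral is an element of the larger one, so equality would contradict
    foundation.\<close>
  have "(vnat m :: 'v) \<noteq> vnat n" if "m < n" for m n
  proof -
    have "(vnat m :: 'v) \<in> elts (vnat n)" using that by (simp add: elts_vnat)
    then show ?thesis using not_mem_self by metis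
  qed
  then show ?thesis by (metis linorder_neqE_nat)
qed

lemma vnat_mem_iff [simp]: "vnat m \<in> elts (vnat n) \<longleftrightarrow> m < n"
  by (auto simp: elts_vnat)

lemma vint_eq_iff [simp]: "vint m = vint n \<longleftrightarrow> m = n"
  by (auto simp: vint_def)

lemma elts_v_Z: "elts v_Z = range vint"
  by (simp add: v_Z_def elts_vset is_set_countable)

lemma elts_v_Z_add:
  "elts v_Z_add = {vpair (vpair (vint a) (vint b)) (vint (a + b)) | a b. True}"
  unfolding v_Z_add_def
proof (rule elts_vset, rule is_set_countable, rule countable_subset)
  show "{vpair (vpair (vint a) (vint b)) (vint (a + b)) | a b. True}
      \<subseteq> range (\<lambda>(a, b). vpair (vpair (vint a) (vint b)) (vint (a + b)))" by auto
qed simp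

lemma elts_v_Z_abs: "elts v_Z_abs = {vpair (vint a) (vnat (nat \<bar>a\<bar>)) | a. True}"
  unfolding v_Z_abs_def
proof (rule elts_vset, rule is_set_countable, rule countable_subset)
  show "{vpair (vint a) (vnat (nat \<bar>a\<bar>)) | a. True}
      \<subseteq> range (\<lambda>a. vpair (vint a) (vnat (nat \<bar>a\<bar>)))" by auto
qed simp

lemma elts_v_graph: "is_set X \<Longrightarrow> elts (v_graph X f) = {vpair x (f x) | x. x \<in> X}"
  unfolding v_graph_def by (rule elts_vset) (simp add: Setcompr_eq_image is_set_image)

lemma elts_v_mult:
  assumes "is_set (carrier G)"
  shows "elts (v_mult G)
    = {vpair (vpair x y) (x \<otimes>\<^bsub>G\<^esub> y) | x y. x \<in> carrier G \<and> y \<in> carrier G}"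
proof -
  \<comment> \<open>In this form the graph of the multiplication is a set by replacement and
    union.\<close>
  have "{vpair (vpair x y) (x \<otimes>\<^bsub>G\<^esub> y) | x y. x \<in> carrier G \<and> y \<in> carrier G}
      = (\<Union>x\<in>carrier G. (\<lambda>y. vpair (vpair x y) (x \<otimes>\<^bsub>G\<^esub> y)) ` carrier G)" by auto
  then show ?thesis unfolding v_mult_def
    using assms by (simp add: elts_vset is_set_UN is_set_image)
qed


section \<open>Equality and membership in the Boolean-valued universe\<close>

lemma le_bmem_E:
  fixes u v :: "('v::set_universe, 'b::{complete_lattice, boolean_algebra}) bname"
  assumes "d \<le> (u \<^bold>\<in> v)"
    and "\<And>j d'. \<lbrakk>j \<in> bindex v; d' \<le> d; d' \<le> bweight v j; d' \<le> (u \<^bold>= bmember v j)\<rbrakk> \<Longrightarrow> d' \<le> b"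
  shows "d \<le> b"
  by (rule ba_le_SUP_E[OF assms(1)[unfolded bmem_def]]) (auto intro: assms(2))

lemma le_bmem_I:
  fixes u v :: "('v::set_universe, 'b::{complete_lattice, boolean_algebra}) bname"
  assumes "j \<in> bindex v" "d \<le> bweight v j" "d \<le> (u \<^bold>= bmember v j)"
  shows "d \<le> (u \<^bold>\<in> v)"
  unfolding bmem_def using assms by (intro SUP_upper2[of j]) auto

lemma le_beq_iff:
  fixes u v :: "('v::set_universe, 'b::{complete_lattice, boolean_algebra}) bname"
  shows "d \<le> (u \<^bold>= v) \<longleftrightarrow>
    (\<forall>i\<in>bindex u. (d \<^bold>\<and> bweight u i) \<le> (bmember u i \<^bold>\<in> v)) \<and>
    (\<forall>j\<in>bindex v. (d \<^bold>\<and> bweight v j) \<le> (bmember v j \<^bold>\<in> u))"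
  by (subst beq_iff_subsets) (simp add: le_INF_iff le_bimp_iff)

lemma le_beqD1:
  fixes u v :: "('v::set_universe, 'b::{complete_lattice, boolean_algebra}) bname"
  assumes "d \<le> (u \<^bold>= v)" "i \<in> bindex u" "d \<le> bweight u i"
  shows "d \<le> (bmember u i \<^bold>\<in> v)"
  using assms le_beq_iff[of d u v] by (auto simp: inf_absorb1)

lemma beq_refl [simp]: "(u \<^bold>= u) = top_class.top"
  for u :: "('v::set_universe, 'b::{complete_lattice, boolean_algebra}) bname"
proof (induction u)
  case BEmpty
  then show ?case by simp
next
  case (BName D N p)
  have "inf top_class.top (p i) \<le> (N i \<^bold>\<in> BName D N p)" if "i \<in> elts D" for i
    using that BName[OF rangeI] by (intro le_bmem_I[of i]) auto
  then have "top_class.top \<le> (BName D N p \<^bold>= BName D N p)"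
    by (subst le_beq_iff) auto
  then show ?case by (simp add: top_unique)
qed

text \<open>An element of \<open>u\<close> is followed into \<open>v\<close> and from there into
  \<open>w\<close>, and conversely. The condition \<open>d\<close> is generalized in the induction
  because each membership step shrinks it.\<close>

lemma le_beq_trans:
  fixes u v w :: "('v::set_universe, 'b::{complete_lattice, boolean_algebra}) bname"
  assumes "d \<le> (u \<^bold>= v)" "d \<le> (v \<^bold>= w)"
  shows "d \<le> (u \<^bold>= w)"
  using assms
proof (induction u arbitrary: v w d)
  case BEmpty
  \<comment> \<open>An element of \<open>w\<close> would be one of \<open>v\<close>, and then some
    element of \<open>v\<close> would lie in the empty name, which has value bottom.\<close>
  have "inf d (bweight w k) \<le> (bmember w k \<^bold>\<in> BEmpty)" if k: "k \<in> bindex w" for k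
  proof -
    have "inf d (bweight w k) \<le> (bmember w k \<^bold>\<in> v)"
      using BEmpty k by (intro le_beqD1) (auto simp: beq_sym[of w] intro: le_infI1)
    then show ?thesis
    proof (rule le_bmem_E)
      fix j d' assume j: "j \<in> bindex v" "d' \<le> inf d (bweight w k)" "d' \<le> bweight v j"
      then have "d' \<le> (bmember v j \<^bold>\<in> BEmpty)"
        using BEmpty by (intro le_beqD1) (auto simp: beq_sym[of v])
      then show "d' \<le> (bmember w k \<^bold>\<in> BEmpty)" by (simp add: bmem_def)
    qed
  qed
  then show ?case by (subst le_beq_iff) simp
next
  case (BName D N p)
  let ?u = "BName D N p"
  have "inf d (p i) \<le> (N i \<^bold>\<in> w)" if i: "i \<in> elts D" for i
  proof -
    have "inf d (p i) \<le> (bmember ?u i \<^bold>\<in> v)"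
      using BName.prems i by (intro le_beqD1) (auto intro: le_infI1)
    then have "inf d (p i) \<le> (N i \<^bold>\<in> v)" by simp
    then show ?thesis
    proof (rule le_bmem_E)
      fix j d' assume j: "j \<in> bindex v" "d' \<le> inf d (p i)" "d' \<le> bweight v j"
        "d' \<le> (N i \<^bold>= bmember v j)"
      have "d' \<le> (bmember v j \<^bold>\<in> w)"
        using BName.prems j by (intro le_beqD1) auto
      then show "d' \<le> (N i \<^bold>\<in> w)"
      proof (rule le_bmem_E)
        fix k d'' assume k: "k \<in> bindex w" "d'' \<le> d'" "d'' \<le> bweight w k"
          "d'' \<le> (bmember v j \<^bold>= bmember w k)"
        have "d'' \<le> (N i \<^bold>= bmember w k)"
          by (rule BName.IH[OF rangeI _ k(4)]) (rule order_trans[OF k(2) j(4)])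
        then show "d'' \<le> (N i \<^bold>\<in> w)" using k by (intro le_bmem_I)
      qed
    qed
  qed
  moreover have "inf d (bweight w k) \<le> (bmember w k \<^bold>\<in> ?u)" if k: "k \<in> bindex w" for k
  proof -
    have "inf d (bweight w k) \<le> (bmember w k \<^bold>\<in> v)"
      using BName.prems k by (intro le_beqD1) (auto simp: beq_sym[of w] intro: le_infI1)
    then show ?thesis
    proof (rule le_bmem_E)
      fix j d' assume j: "j \<in> bindex v" "d' \<le> inf d (bweight w k)" "d' \<le> bweight v j"
        "d' \<le> (bmember w k \<^bold>= bmember v j)"
      have "d' \<le> (bmember v j \<^bold>\<in> ?u)"
        using BName.prems j by (intro le_beqD1) (auto simp: beq_sym[of v])
      then show "d' \<le> (bmember w k \<^bold>\<in> ?u)"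
      proof (rule le_bmem_E)
        fix i d'' assume i: "i \<in> bindex ?u" "d'' \<le> d'" "d'' \<le> bweight ?u i"
          "d'' \<le> (bmember v j \<^bold>= bmember ?u i)"
        \<comment> \<open>The chain now runs from \<open>w\<close> to \<open>u\<close>. Symmetry
          reverses it, so that \<open>N i\<close>, the name covered by the induction hypothesis,
          again stands on the left.\<close>
        have "d'' \<le> (N i \<^bold>= bmember w k)"
        proof (rule BName.IH[OF rangeI])
          show "d'' \<le> (N i \<^bold>= bmember v j)"
            using i(4) by (simp add: beq_sym[of _ "N i"])
          show "d'' \<le> (bmember v j \<^bold>= bmember w k)"
            using order_trans[OF i(2) j(4)] by (simp add: beq_sym[of "bmember v j"])
        qed
        then show "d'' \<le> (bmember w k \<^bold>\<in> ?u)"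
          using i by (intro le_bmem_I[of i]) (auto simp: beq_sym[of "bmember w k"])
      qed
    qed
  qed
  ultimately show ?case by (subst le_beq_iff) simp
qed

lemma le_bmem_cong_left:
  fixes u u' v :: "('v::set_universe, 'b::{complete_lattice, boolean_algebra}) bname"
  assumes "d \<le> (u \<^bold>= u')" "d \<le> (u \<^bold>\<in> v)"
  shows "d \<le> (u' \<^bold>\<in> v)"
  using assms(2)
proof (rule le_bmem_E)
  fix j d' assume j: "j \<in> bindex v" "d' \<le> d" "d' \<le> bweight v j" "d' \<le> (u \<^bold>= bmember v j)"
  have "d' \<le> (u' \<^bold>= u)" using order_trans[OF j(2) assms(1)] by (simp add: beq_sym[of u'])
  then have "d' \<le> (u' \<^bold>= bmember v j)" using j(4) by (rule le_beq_trans)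
  then show "d' \<le> (u' \<^bold>\<in> v)" by (rule le_bmem_I[OF j(1,3)])
qed

lemma le_bmem_cong_right:
  fixes u v v' :: "('v::set_universe, 'b::{complete_lattice, boolean_algebra}) bname"
  assumes "d \<le> (v \<^bold>= v')" "d \<le> (u \<^bold>\<in> v)"
  shows "d \<le> (u \<^bold>\<in> v')"
  using assms(2)
proof (rule le_bmem_E)
  fix j d' assume j: "j \<in> bindex v" "d' \<le> d" "d' \<le> bweight v j" "d' \<le> (u \<^bold>= bmember v j)"
  have "d' \<le> (bmember v j \<^bold>\<in> v')"
    using order_trans[OF j(2) assms(1)] j by (intro le_beqD1)
  moreover have "d' \<le> (bmember v j \<^bold>= u)" using j(4) by (subst beq_sym)
  ultimately show "d' \<le> (u \<^bold>\<in> v')" by (rule le_bmem_cong_left[rotated])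
qed

lemma inf_beq_cong:
  fixes w y y' :: "('v::set_universe, 'b::{complete_lattice, boolean_algebra}) bname"
  assumes "d \<le> (y \<^bold>= y')"
  shows "(d \<^bold>\<and> (w \<^bold>= y)) = (d \<^bold>\<and> (w \<^bold>= y'))"
proof -
  have "inf d (w \<^bold>= y) \<le> (w \<^bold>= y')" if "d \<le> (y \<^bold>= y')" for y y'
    using that by (rule le_beq_trans[OF inf_le2 le_infI1])
  from this[of y y'] this[of y' y] show ?thesis
    using assms by (simp add: order_eq_iff beq_sym[of y'])
qed

text \<open>The axiom of extensionality below \<open>d\<close>: taking for \<open>w\<close> the
  members listed in \<open>z\<close> and in \<open>v\<close> gives the two inclusions.\<close>

lemma le_beq_extensionality:
  fixes z v :: "('v::set_universe, 'b::{complete_lattice, boolean_algebra}) bname"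
  assumes "\<And>w. (d \<^bold>\<and> (w \<^bold>\<in> z)) = (d \<^bold>\<and> (w \<^bold>\<in> v))"
  shows "d \<le> (z \<^bold>= v)"
proof -
  have *: "bweight z i \<le> (bmember z i \<^bold>\<in> z)" if "i \<in> bindex z" for z :: "('v, 'b) bname" and i
    using that by (intro le_bmem_I) auto
  have "inf d (bweight z i) \<le> (bmember z i \<^bold>\<in> v)"
    if i: "i \<in> bindex z" and eq: "\<And>w. inf d (w \<^bold>\<in> z) = inf d (w \<^bold>\<in> v)"
    for z v :: "('v, 'b) bname" and i
  proof -
    have "inf d (bweight z i) \<le> inf d (bmember z i \<^bold>\<in> z)"
      using *[OF i] by (intro inf_mono) auto
    then show ?thesis unfolding eq by simp
  qed
  then show ?thesis using assms by (subst le_beq_iff) simp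
qed


subsection \<open>Canonical names\<close>

lemma bmem_check: "(u \<^bold>\<in> check x) = (SUP y\<in>elts x. u \<^bold>= check y)"
  for u :: "('v::set_universe, 'b::{complete_lattice, boolean_algebra}) bname"
  unfolding bmem_def by (simp add: check.simps[of x])

lemma bmem_check_upair:
  "(u \<^bold>\<in> check (vset {x, y})) = ((u \<^bold>= check x) \<^bold>\<or> (u \<^bold>= check y))"
  for u :: "('v::set_universe, 'b::{complete_lattice, boolean_algebra}) bname"
  by (simp add: bmem_check)

lemma bmem_check_of_mem [simp]:
  "x \<in> elts y \<Longrightarrow> (check x \<^bold>\<in> (check y
      :: ('v::set_universe, 'b::{complete_lattice, boolean_algebra}) bname)) = top_class.top"
  unfolding bmem_check by (rule top_le) (auto intro: SUP_upper2)

text \<open>By induction on membership: if \<open>z\<close> separates \<open>x\<close> from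
  \<open>y\<close>, equality of the check names would force \<open>check z\<close> into the wrong
  one, and that membership is a join of equalities which all vanish by the induction
  hypothesis.\<close>

lemma beq_check_neq:
  "x \<noteq> y \<Longrightarrow> ((check x
      :: ('v::set_universe, 'b::{complete_lattice, boolean_algebra}) bname) \<^bold>= check y) = bot_class.bot"
proof (induction x arbitrary: y rule: wf_induct_rule[OF foundation])
  case (1 x)
  have neq: "((check a :: ('v, 'b) bname) \<^bold>= check b) = bot_class.bot" if "a \<in> elts x" "a \<noteq> b" for a b
    using 1(1)[of a b] that by simp
  from 1(2) obtain z where "z \<in> elts x \<and> z \<notin> elts y \<or> z \<in> elts y \<and> z \<notin> elts x"
    using extensionality[of x y] by blast
  then have "((check x :: ('v, 'b) bname) \<^bold>= check y) \<le> bot_class.bot"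
  proof
    assume z: "z \<in> elts x \<and> z \<notin> elts y"
    have "(check x \<^bold>= check y) \<le> ((check z :: ('v, 'b) bname) \<^bold>\<in> check y)"
      by (rule le_bmem_cong_right[of _ "check x"]) (use z in auto)
    also have "\<dots> = bot_class.bot"
      by (simp only: bmem_check SUP_bot_conv) (metis neq z)
    finally show ?thesis .
  next
    \<comment> \<open>Here \<open>z\<close> is compared with the elements of \<open>x\<close>, so
      the induction hypothesis applies to those elements, after a use of symmetry.\<close>
    assume z: "z \<in> elts y \<and> z \<notin> elts x"
    have "(check x \<^bold>= check y) \<le> ((check z :: ('v, 'b) bname) \<^bold>\<in> check x)"
      by (rule le_bmem_cong_right[of _ "check y"]) (use z in \<open>auto simp: beq_sym\<close>)
    also have "\<dots> = bot_class.bot"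
      by (simp only: bmem_check SUP_bot_conv) (metis neq z beq_sym)
    finally show ?thesis .
  qed
  then show ?case by (simp add: bot_unique)
qed

lemma bmem_check_not_mem:
  "x \<notin> elts y \<Longrightarrow> (check x \<^bold>\<in> (check y
      :: ('v::set_universe, 'b::{complete_lattice, boolean_algebra}) bname)) = bot_class.bot"
  unfolding bmem_check by (auto simp: SUP_bot_conv intro!: beq_check_neq)


subsection \<open>Ordered pairs\<close>

text \<open>Extensionality gives one direction and substitution the other. The quantifier over all
  names disappears, which makes pairs of check names computable.\<close>

lemma b_upair_check:
  fixes z :: "('v::set_universe, 'b::{complete_lattice, boolean_algebra}) bname"
  shows "b_upair z (check x) (check y) = (z \<^bold>= check (vset {x, y}))"
proof (rule antisym)
  show "b_upair z (check x) (check y) \<le> (z \<^bold>= check (vset {x, y}))"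
    by (rule le_beq_extensionality)
      (simp only: bmem_check_upair flip: le_biff_iff, unfold b_upair_def, rule b_all_lower)
  show "(z \<^bold>= check (vset {x, y})) \<le> b_upair z (check x) (check y)"
    unfolding b_upair_def le_b_all_iff le_biff_iff bmem_check_upair[symmetric]
  proof
    fix w
    let ?d = "z \<^bold>= check (vset {x, y})"
    have "inf ?d (w \<^bold>\<in> z) \<le> (w \<^bold>\<in> check (vset {x, y}))"
      by (rule le_bmem_cong_right[of _ z]) auto
    moreover have "inf ?d (w \<^bold>\<in> check (vset {x, y})) \<le> (w \<^bold>\<in> z)"
      by (rule le_bmem_cong_right[of _ "check (vset {x, y})"]) (auto simp: beq_sym)
    ultimately show "inf ?d (w \<^bold>\<in> z) = inf ?d (w \<^bold>\<in> check (vset {x, y}))"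
      by (intro antisym) auto
  qed
qed

lemma b_pair_check [simp]:
  "b_pair (check (vpair x y)
      :: ('v::set_universe, 'b::{complete_lattice, boolean_algebra}) bname) (check x) (check y) = top_class.top"
proof (rule top_le)
  show "top_class.top \<le> b_pair (check (vpair x y) :: ('v, 'b) bname) (check x) (check y)"
    unfolding b_pair_def le_b_all_iff le_biff_iff b_upair_check
    by (simp add: bmem_check elts_vpair)
qed

lemma inf_b_upair_cong:
  fixes y y' :: "('v::set_universe, 'b::{complete_lattice, boolean_algebra}) bname"
  assumes "d \<le> (y \<^bold>= y')"
  shows "(d \<^bold>\<and> b_upair z x y) = (d \<^bold>\<and> b_upair z x y')"
proof -
  have "inf d (b_upair z x y) \<le> b_upair z x y'" if d: "d \<le> (y \<^bold>= y')" for y y'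
    unfolding b_upair_def[of z x y'] le_b_all_iff le_biff_iff
  proof
    fix w
    let ?c = "inf d (b_upair z x y)"
    have "?c \<le> ((w \<^bold>\<in> z) \<^bold>\<longleftrightarrow> ((w \<^bold>= x) \<^bold>\<or> (w \<^bold>= y)))"
      unfolding b_upair_def by (rule le_infI2) (rule b_all_lower)
    moreover have "inf ?c (w \<^bold>= y) = inf ?c (w \<^bold>= y')"
      by (rule inf_beq_cong) (rule le_infI1[OF d])
    ultimately show "inf ?c (w \<^bold>\<in> z) = inf ?c ((w \<^bold>= x) \<^bold>\<or> (w \<^bold>= y'))"
      by (simp add: le_biff_iff inf_sup_distrib1)
  qed
  from this[of y y'] this[of y' y] show ?thesis
    using assms by (simp add: order_eq_iff beq_sym[of y'])
qed

text \<open>Substitution is made in the second coordinate, since the argument of \<sigma> is already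
  a check name and its value is still to be replaced by one.\<close>

lemma le_b_pair_cong:
  fixes y y' :: "('v::set_universe, 'b::{complete_lattice, boolean_algebra}) bname"
  assumes "d \<le> (y \<^bold>= y')" "d \<le> b_pair p x y"
  shows "d \<le> b_pair p x y'"
  using assms(2) inf_b_upair_cong[OF assms(1)]
  unfolding b_pair_def le_b_all_iff le_biff_iff by (simp add: inf_sup_distrib1)

lemma le_b_pair_in_cong:
  fixes y y' :: "('v::set_universe, 'b::{complete_lattice, boolean_algebra}) bname"
  assumes "d \<le> (y \<^bold>= y')" "d \<le> b_pair_in x y f"
  shows "d \<le> b_pair_in x y' f"
  using assms(2)[unfolded b_pair_in_def]
proof (rule le_b_ex_E)
  fix p d' assume p: "d' \<le> d" "d' \<le> (b_pair p x y \<^bold>\<and> (p \<^bold>\<in> f))"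
  have "d' \<le> b_pair p x y'"
    using le_b_pair_cong[OF order_trans[OF p(1) assms(1)]] p(2) by simp
  then show "d' \<le> b_pair_in x y' f"
    unfolding b_pair_in_def using p(2) by (intro le_b_ex_I[of _ _ p]) simp
qed

lemma le_b_pair_in_checkI:
  fixes f :: "('v::set_universe, 'b::{complete_lattice, boolean_algebra}) bname"
  assumes "d \<le> (check (vpair x y) \<^bold>\<in> f)"
  shows "d \<le> b_pair_in (check x) (check y) f"
  unfolding b_pair_in_def using assms by (intro le_b_ex_I[of _ _ "check (vpair x y)"]) simp

lemma b_pair_in_check [simp]:
  "vpair x y \<in> elts r \<Longrightarrow> b_pair_in (check x) (check y) (check r
      :: ('v::set_universe, 'b::{complete_lattice, boolean_algebra}) bname) = top_class.top"
  by (rule top_le) (rule le_b_pair_in_checkI, simp)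

lemma b_triple_in_check [simp]:
  assumes "vpair (vpair x y) z \<in> elts r"
  shows "b_triple_in (check x) (check y) (check z) (check r
      :: ('v::set_universe, 'b::{complete_lattice, boolean_algebra}) bname) = top_class.top"
  unfolding b_triple_in_def
  using assms by (intro top_le le_b_ex_I[of _ _ "check (vpair x y)"]) simp


section \<open>The values of a homomorphism in the Boolean-valued universe\<close>

text \<open>The value is at first an arbitrary name \<open>y\<close> in \<open>check Y\<close>. That
  membership is a join of equalities with check names, and substitution moves each equality into the
  pair.\<close>

lemma le_b_hom_total:
  fixes f :: "('v::set_universe, 'b::{complete_lattice, boolean_algebra}) bname"
  assumes "d \<le> b_hom f (check X) mX (check Y) mY" "x \<in> elts X"
  shows "d \<le> (SUP y\<in>elts Y. b_pair_in (check x) (check y) f)"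
proof -
  have "d \<le> ((check x \<^bold>\<in> check X) \<^bold>\<longrightarrow> (\<^bold>\<exists>y. (y \<^bold>\<in> check Y) \<^bold>\<and> b_pair_in (check x) y f))"
    using assms(1) by (simp add: b_hom_def b_function_def le_b_all_iff)
  then have "d \<le> (\<^bold>\<exists>y. (y \<^bold>\<in> check Y) \<^bold>\<and> b_pair_in (check x) y f)"
    by (rule le_bimpD) (simp add: assms(2))
  then show ?thesis
  proof (rule le_b_ex_E)
    fix y d' assume y: "d' \<le> ((y \<^bold>\<in> check Y) \<^bold>\<and> b_pair_in (check x) y f)"
    then have "d' \<le> (SUP z\<in>elts Y. y \<^bold>= check z)" by (simp add: bmem_check)
    then show "d' \<le> (SUP y\<in>elts Y. b_pair_in (check x) (check y) f)"
    proof (rule ba_le_SUP_E)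
      fix z d'' assume z: "z \<in> elts Y" "d'' \<le> d'" "d'' \<le> (y \<^bold>= check z)"
      have "d'' \<le> b_pair_in (check x) (check z) f"
        using le_b_pair_in_cong[OF z(3)] y z(2) by (meson le_inf_iff order_trans)
      then show "d'' \<le> (SUP y\<in>elts Y. b_pair_in (check x) (check y) f)"
        using z(1) by (intro SUP_upper2)
    qed
  qed
qed

lemma le_b_hom_unique:
  fixes f :: "('v::set_universe, 'b::{complete_lattice, boolean_algebra}) bname"
  assumes "d \<le> b_hom f X mX Y mY" "d \<le> b_pair_in x y f" "d \<le> b_pair_in x y' f"
  shows "d \<le> (y \<^bold>= y')"
proof -
  have "d \<le> ((b_pair_in x y f \<^bold>\<and> b_pair_in x y' f) \<^bold>\<longrightarrow> (y \<^bold>= y'))"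
    using assms(1) by (simp add: b_hom_def b_function_def le_b_all_iff)
  then show ?thesis by (rule le_bimpD) (simp add: assms)
qed

lemma le_b_hom_mult:
  fixes f :: "('v::set_universe, 'b::{complete_lattice, boolean_algebra}) bname"
  assumes "d \<le> b_hom f X mX Y mY" "d \<le> b_triple_in x x' x'' mX"
    "d \<le> b_pair_in x y f" "d \<le> b_pair_in x' y' f" "d \<le> b_triple_in y y' y'' mY"
  shows "d \<le> b_pair_in x'' y'' f"
proof -
  have "d \<le> ((b_triple_in x x' x'' mX \<^bold>\<and> b_pair_in x y f \<^bold>\<and> b_pair_in x' y' f \<^bold>\<and>
         b_triple_in y y' y'' mY) \<^bold>\<longrightarrow> b_pair_in x'' y'' f)"
    using assms(1) by (simp add: b_hom_def le_b_all_iff)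
  then show ?thesis by (rule le_bimpD) (simp add: assms)
qed

lemma le_b_restriction_check:
  fixes f :: "('v::set_universe, 'b::{complete_lattice, boolean_algebra}) bname"
  assumes "d \<le> b_restriction f X (check g)" "vpair x y \<in> elts g"
  shows "d \<le> b_pair_in (check x) (check y) f"
proof (rule le_b_pair_in_checkI)
  let ?p = "check (vpair x y) :: ('v, 'b) bname"
  have "d \<le> ((?p \<^bold>\<in> check g) \<^bold>\<longleftrightarrow> ((?p \<^bold>\<in> f) \<^bold>\<and> (\<^bold>\<exists>x. \<^bold>\<exists>y. (x \<^bold>\<in> X) \<^bold>\<and> b_pair ?p x y)))"
    using assms(1) by (simp add: b_restriction_def le_b_all_iff)
  \<comment> \<open>The pair belongs to the ground graph, so the left side of the equivalence has
    value top and its meet with \<open>d\<close> is \<open>d\<close>.\<close>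
  then have "d = inf d (inf (?p \<^bold>\<in> f) (\<^bold>\<exists>x. \<^bold>\<exists>y. (x \<^bold>\<in> X) \<^bold>\<and> b_pair ?p x y))"
    using assms(2) by (simp add: le_biff_iff)
  also have "\<dots> \<le> (?p \<^bold>\<in> f)" by (rule le_infI2[OF inf_le1])
  finally show "d \<le> (?p \<^bold>\<in> f)" .
qed

lemma le_b_abs_bounded_check:
  fixes f :: "('v::set_universe, 'b::{complete_lattice, boolean_algebra}) bname"
  assumes "d \<le> b_abs_bounded f (check v_Z_abs) (check (v_graph S (\<lambda>y. vnat (e y)))) (check (vset S))"
    and S: "is_set S" "y \<in> S" and "d \<le> b_pair_in (check y) (check (vint n)) f"
    and n: "\<not> \<bar>n\<bar> \<le> int (e y)"
  shows "d = bot_class.bot"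
proof -
  \<comment> \<open>These are the ground values of the absolute value and of the bound. When the
    bound fails in the ground universe, both disjuncts of the conclusion have value bottom.\<close>
  let ?m = "vnat (nat \<bar>n\<bar>) :: 'v" and ?k = "vnat (e y) :: 'v"
  have "d \<le> (((check y \<^bold>\<in> check (vset S)) \<^bold>\<and> b_pair_in (check y) (check (vint n)) f \<^bold>\<and>
      b_pair_in (check (vint n)) (check ?m) (check v_Z_abs) \<^bold>\<and>
      b_pair_in (check y) (check ?k) (check (v_graph S (\<lambda>y. vnat (e y)))))
      \<^bold>\<longrightarrow> ((check ?m \<^bold>\<in> check ?k) \<^bold>\<or> (check ?m \<^bold>= check ?k)))"
    using assms(1) unfolding b_abs_bounded_def le_b_all_iff by blast
  moreover have "vpair (vint n) ?m \<in> elts v_Z_abs" by (auto simp: elts_v_Z_abs)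
  moreover have "vpair y ?k \<in> elts (v_graph S (\<lambda>y. vnat (e y)))"
    using S by (auto simp: elts_v_graph)
  ultimately have "d \<le> ((check ?m \<^bold>\<in> check ?k) \<^bold>\<or> (check ?m \<^bold>= check ?k))"
    by (elim le_bimpD) (use assms(4) S in \<open>simp add: elts_vset\<close>)
  moreover have "((check ?m :: ('v, 'b) bname) \<^bold>\<in> check ?k) = bot_class.bot"
    using n by (intro bmem_check_not_mem) auto
  moreover have "((check ?m :: ('v, 'b) bname) \<^bold>= check ?k) = bot_class.bot"
    using n by (intro beq_check_neq) auto
  ultimately show ?thesis by (simp add: bot_unique)
qed

section \<open>From a Boolean-valued homomorphism to an extension of \<tau> in the ground
  universe\<close>

theorem theorem9p5:
  fixes A F :: "'v::set_universe monoid"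
    and K BF :: "'v set"
    and g :: "'v \<Rightarrow> 'v"
    and \<tau> :: "'v \<Rightarrow> int"
    and e :: "'v \<Rightarrow> nat"
  assumes A: "comm_group A" "is_set (carrier A)" "\<not> Whitehead A"
    and F: "is_free_abelian F" "is_set (carrier F)"
    and K: "subgroup K F" "is_free_abelian (F\<lparr>carrier := K\<rparr>)"
    and exact: "short_exact_sequence A F (F\<lparr>carrier := K\<rparr>) g id"
    and tau: "\<tau> \<in> hom (F\<lparr>carrier := K\<rparr>) integer_group"
    and no_extension: "\<not> (\<exists>\<sigma> \<in> hom F integer_group. \<forall>x \<in> K. \<sigma> x = \<tau> x)"
    and basis: "is_basis F BF"
    and B_in_V: "\<exists>b::'v. elts b \<approx> (UNIV :: 'b::{complete_lattice, boolean_algebra} set)"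
  shows "(\<^bold>\<not> (\<^bold>\<exists>\<sigma> :: ('v, 'b) bname.
            b_hom \<sigma> (check (vset (carrier F))) (check (v_mult F)) (check v_Z) (check v_Z_add) \<^bold>\<and>
            b_restriction \<sigma> (check (vset K)) (check (v_graph K (\<lambda>x. vint (\<tau> x)))) \<^bold>\<and>
            b_abs_bounded \<sigma> (check v_Z_abs) (check (v_graph BF (\<lambda>y. vnat (e y)))) (check (vset BF))))
         = top_class.top"
proof -
  interpret F: comm_group F using F(1) by (simp add: is_free_abelian_def)
  have KF: "K \<subseteq> carrier F" using K(1) by (rule subgroup.subset)
  have BF: "BF \<subseteq> carrier F" using basis by (simp add: is_basis_def)
  have is_set: "is_set K" "is_set BF" using is_set_subset[OF F(2)] KF BF by auto
  {
    \<comment> \<open>Each name is handled separately: once every conjunction has value bottom, so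
      does the join over all names, and its complement is top.\<close>
    fix \<sigma> :: "('v, 'b) bname"
    define c where "c =
      (b_hom \<sigma> (check (vset (carrier F))) (check (v_mult F)) (check v_Z) (check v_Z_add) \<^bold>\<and>
       b_restriction \<sigma> (check (vset K)) (check (v_graph K (\<lambda>x. vint (\<tau> x)))) \<^bold>\<and>
       b_abs_bounded \<sigma> (check v_Z_abs) (check (v_graph BF (\<lambda>y. vnat (e y)))) (check (vset BF)))"
    have hom: "d \<le> b_hom \<sigma> (check (vset (carrier F))) (check (v_mult F)) (check v_Z) (check v_Z_add)"
      and res: "d \<le> b_restriction \<sigma> (check (vset K)) (check (v_graph K (\<lambda>x. vint (\<tau> x))))"
      and bdd: "d \<le> b_abs_bounded \<sigma> (check v_Z_abs) (check (v_graph BF (\<lambda>y. vnat (e y)))) (check (vset BF))"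
      if "d \<le> c" for d
      using that unfolding c_def by auto
    let ?P = "\<lambda>x n. b_pair_in (check x) (check (vint n)) \<sigma>"
    have "c = bot_class.bot"
    proof (rule ccontr)
      assume c: "c \<noteq> bot_class.bot"
      have "\<exists>s\<in>hom F integer_group. \<forall>x\<in>carrier F. \<forall>n. c \<le> ?P x n \<longrightarrow> s x = n"
      proof (rule F.hom_from_boolean_values[OF basis c])
        show "c \<le> (SUP n. ?P x n)" if "x \<in> carrier F" for x
          using le_b_hom_total[OF hom[OF order_refl], of x] that F(2)
          by (simp add: elts_vset elts_v_Z image_image)
        show "d = bot_class.bot"
          if "d \<le> c" "d \<le> ?P x m" "d \<le> ?P x n" "m \<noteq> n" for x m n d
          using le_b_hom_unique[OF hom[OF that(1)] that(2,3)] that(4)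
          by (simp add: beq_check_neq bot_unique)
        show "d \<le> ?P (x \<otimes>\<^bsub>F\<^esub> y) (m + n)"
          if xy: "x \<in> carrier F" "y \<in> carrier F" and d: "d \<le> c" "d \<le> ?P x m" "d \<le> ?P y n"
          for x y m n d
        proof (rule le_b_hom_mult[OF hom[OF d(1)] _ d(2,3)])
          have "vpair (vpair x y) (x \<otimes>\<^bsub>F\<^esub> y) \<in> elts (v_mult F)"
            using xy F(2) by (auto simp: elts_v_mult)
          then show "d \<le> b_triple_in (check x) (check y) (check (x \<otimes>\<^bsub>F\<^esub> y)) (check (v_mult F))"
            by simp
          have "vpair (vpair (vint m) (vint n)) (vint (m + n)) \<in> elts (v_Z_add :: 'v)"
            by (auto simp: elts_v_Z_add)
          then show "d \<le> b_triple_in (check (vint m)) (check (vint n)) (check (vint (m + n)))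
              (check v_Z_add :: ('v, 'b) bname)"
            by simp
        qed
        show "d = bot_class.bot"
          if "y \<in> BF" "d \<le> c" "d \<le> ?P y n" "\<not> \<bar>n\<bar> \<le> int (e y)" for y n d
          using le_b_abs_bounded_check[OF bdd[OF that(2)] is_set(2) that(1,3,4)] .
      qed
      then obtain s where s: "s \<in> hom F integer_group"
        and eq: "\<And>x n. \<lbrakk>x \<in> carrier F; c \<le> ?P x n\<rbrakk> \<Longrightarrow> s x = n" by blast
      \<comment> \<open>On \<open>K\<close> the whole of \<open>c\<close>, and not only
        \<open>U\<close>, decides the value of \<sigma>, through the restriction clause. Hence
        \<open>s\<close> extends \<tau>, against \<open>no_extension\<close>.\<close>
      have "s x = \<tau> x" if "x \<in> K" for x
      proof (rule eq)
        show "c \<le> ?P x (\<tau> x)"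
          by (rule le_b_restriction_check[OF res[OF order_refl]])
            (use that is_set(1) in \<open>auto simp: elts_v_graph\<close>)
      qed (use that KF in auto)
      then show False using no_extension s by blast
    qed
  }
  then show ?thesis by (simp add: b_ex_def)
qed

end
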